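(* Let $k\ge 0$ be a fixed integer. The polynomial sequence $(B_q(n,k))_{n\ge k}$ is $q$-log-concave; that is, for all $n\ge k+1$ the polynomial $B_q(n,k)^2-B_q(n-1,k)\,B_q(n+1,k)$ in $q$ has only nonnegative coefficients.
   Context: For $0\le k\le n$ the $q$-refined Baxter number is $$B_q(n,k)=q^{\frac{3k(k-1)}{2}}\,\frac{\begin{bmatrix} n\\ k\end{bmatrix}_q\begin{bmatrix} n+1\\ k\end{bmatrix}_q\begin{bmatrix} n+2\\ k\end{bmatrix}_q}{\begin{bmatrix} k+1\\ k\end{bmatrix}_q\begin{bmatrix} k+2\\ k\end{bmatrix}_q},$$ where $[m]_q=\frac{1-q^m}{1-q}$, $[m]_q!=[1]_q[2]_q\cdots[m]_q$ and $\begin{bmatrix} n\\ k\end{bmatrix}_q=\frac{[n]_q!}{[k]_q!\,[n-k]_q!}$. It is a polynomial in $q$. A sequence of real polynomials $(f_n(q))$ is $q$-log-concave if $f_n(q)^2-f_{n-1}(q)f_{n+1}(q)$ has only nonnegative coefficients for every interior index $n$. *)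

theory Defs
  imports "HOL-Computational_Algebra.Computational_Algebra"
begin

text \<open>
  The quotients defining the \<open>q\<close>-analogues are taken in the field of rational functions
  in \<open>q\<close> over the reals, in which \<open>to_fract\<close> embeds the polynomials.
\<close>

definition qvar :: "real poly fract" where
  "qvar = to_fract [:0, 1:]"

definition q_num :: "nat \<Rightarrow> real poly fract" where
  "q_num m = (1 - qvar ^ m) / (1 - qvar)"

definition q_fact :: "nat \<Rightarrow> real poly fract" where
  "q_fact m = (\<Prod>i=1..m. q_num i)"

text \<open>Only meaningful for \<open>k \<le> n\<close>, since \<open>n - k\<close> is truncated subtraction.\<close>

definition q_binom :: "nat \<Rightarrow> nat \<Rightarrow> real poly fract" where
  "q_binom n k = q_fact n / (q_fact k * q_fact (n - k))"

definition q_baxter_fract :: "nat \<Rightarrow> nat \<Rightarrow> real poly fract" where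
  "q_baxter_fract n k =
     qvar ^ (3 * k * (k - 1) div 2) *
     (q_binom n k * q_binom (n + 1) k * q_binom (n + 2) k) /
     (q_binom (k + 1) k * q_binom (k + 2) k)"

text \<open>
  The same number as a polynomial in \<open>q\<close>; that it is one for \<open>k \<le> n\<close> is the content
  of \<open>to_fract_q_baxter\<close> below.
\<close>

definition q_baxter :: "nat \<Rightarrow> nat \<Rightarrow> real poly" where
  "q_baxter n k = (THE p. to_fract p = q_baxter_fract n k)"

text \<open>\<open>q\<close>-log-concavity of the sequence \<open>f m, f (m + 1), \<dots>\<close>\<close>

definition q_log_concave_from :: "nat \<Rightarrow> (nat \<Rightarrow> real poly) \<Rightarrow> bool" where
  "q_log_concave_from m f \<longleftrightarrow>
     (\<forall>n\<ge>m + 1. \<forall>i. 0 \<le> coeff ((f n)\<^sup>2 - f (n - 1) * f (n + 1)) i)"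


lemma to_fract_power: "to_fract (p ^ n) = to_fract p ^ n"
  by (induction n) auto

lemma qvar_power_eq_1_iff [simp]: "qvar ^ n = 1 \<longleftrightarrow> n = 0"
proof
  assume "qvar ^ n = 1"
  hence "to_fract ([:0, 1:] ^ n :: real poly) = to_fract 1"
    by (simp add: qvar_def to_fract_power)
  hence "[:0, 1:] ^ n = (1 :: real poly)" by (simp only: to_fract_eq_iff)
  hence "degree ([:0, 1:] ^ n :: real poly) = 0" by simp
  thus "n = 0" by (simp add: degree_power_eq)
qed auto

lemma qvar_nz [simp]: "qvar \<noteq> 0"
  by (simp add: qvar_def)

lemma qvar_ne_1 [simp]: "qvar \<noteq> 1"
  using qvar_power_eq_1_iff[of 1] by simp

lemma q_num_0 [simp]: "q_num 0 = 0"
  by (simp add: q_num_def)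

lemma q_num_eq_0_iff [simp]: "q_num n = 0 \<longleftrightarrow> n = 0"
  by (auto simp: q_num_def eq_commute[of 1])

lemma q_fact_nz [simp]: "q_fact n \<noteq> 0"
  by (auto simp: q_fact_def)

lemma q_fact_0 [simp]: "q_fact 0 = 1"
  by (simp add: q_fact_def)

lemma q_fact_Suc [simp]: "q_fact (Suc n) = q_fact n * q_num (Suc n)"
  by (simp add: q_fact_def)

lemma q_num_add: "q_num (m + n) = q_num m + qvar ^ m * q_num n"
proof -
  have "q_num m + qvar ^ m * q_num n = ((1 - qvar ^ m) + qvar ^ m * (1 - qvar ^ n)) / (1 - qvar)"
    by (simp only: q_num_def add_divide_distrib times_divide_eq_right)
  thus ?thesis by (simp add: q_num_def power_add algebra_simps)
qed

lemma q_binom_Suc_Suc: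
  assumes "k < n"
  shows "q_binom (Suc n) (Suc k) = q_binom n (Suc k) + qvar ^ (n - k) * q_binom n k"
proof -
  obtain d where n: "n = Suc (k + d)" using assms less_iff_Suc_add by auto
  have *: "q_num (Suc n) = q_num (Suc d) + qvar ^ Suc d * q_num (Suc k)"
    using q_num_add[of "Suc d" "Suc k"] by (simp add: n add_ac)
  have "n - k = Suc d" "n - Suc k = d" "Suc n - Suc k = Suc d" using n by auto
  thus ?thesis unfolding q_binom_def q_fact_Suc[of n] *
    by (simp add: divide_simps algebra_simps)
qed

lemma q_binom_poly: "k \<le> n \<Longrightarrow> q_binom n k \<in> range to_fract"
proof (induction n arbitrary: k)
  case 0
  thus ?case by (auto simp: q_binom_def intro!: image_eqI[of _ _ 1])
next
  case (Suc n)
  show ?case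
  proof (cases k)
    case 0
    thus ?thesis by (auto simp: q_binom_def simp del: q_fact_Suc intro!: image_eqI[of _ _ 1])
  next
    case (Suc l)
    show ?thesis
    proof (cases "l < n")
      case True
      obtain a b where ab: "q_binom n (Suc l) = to_fract a" "q_binom n l = to_fract b"
        using Suc.IH[of "Suc l"] Suc.IH[of l] True by auto
      have "q_binom (Suc n) k = to_fract (a + [:0, 1:] ^ (n - l) * b)"
        unfolding Suc q_binom_Suc_Suc[OF True] ab by (simp add: to_fract_power qvar_def)
      thus ?thesis by blast
    next
      case False
      hence "k = Suc n" using Suc Suc.prems by auto
      thus ?thesis by (auto simp: q_binom_def simp del: q_fact_Suc intro!: image_eqI[of _ _ 1])
    qed
  qed
qed

text \<open>
  Apart from the power of \<open>q\<close> in front, the Baxter number is the determinant of the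
  matrix with entries \<open>q ^ (e * (e + 1) / 2) * q_binom n (k + e)\<close>, where \<open>e = j - i\<close> for
  \<open>1 \<le> i, j \<le> 3\<close> and the binomial is zero outside \<open>0 \<le> k + e \<le> n\<close>. After division by
  \<open>q_binom n k ^ 3\<close> this is an identity in \<open>a = q ^ k\<close> and \<open>b = q ^ (n - k)\<close>. Here \<open>R1\<close>
  and \<open>L1\<close> are the ratios for \<open>e = 1\<close> and \<open>e = - 1\<close>, and \<open>R2\<close> and \<open>L2\<close> are \<open>q\<close> times
  those for \<open>e = 2\<close> and \<open>e = - 2\<close>.
\<close>

lemma baxter_det_identity:
  fixes q a b :: "'a :: field"
  assumes nz: "1 - a*q \<noteq> 0" "1 - a*q^2 \<noteq> 0" "1 - b*q \<noteq> 0" "1 - b*q^2 \<noteq> 0"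
  defines "R1 \<equiv> (1-b)/(1-a*q)" and "L1 \<equiv> (1-a)/(1-b*q)"
  defines "R2 \<equiv> (1-b)*(q-b)/((1-a*q)*(1-a*q^2))" and "L2 \<equiv> (1-a)*(q-a)/((1-b*q)*(1-b*q^2))"
  shows "1 + q^2*R1^2*L2 + q^2*R2*L1^2 - q^2*R2*L2 - 2*q*R1*L1 =
    (1-a*b*q)^2*(1-a*b*q^2)*(1-q^2)*(1-q)^2 / ((1-b*q)^2*(1-b*q^2)*(1-a*q)^2*(1-a*q^2))"
proof -
  define s t u v where d: "s = 1 - a*q" "t = 1 - a*q^2" "u = 1 - b*q" "v = 1 - b*q^2"
  have nz': "s \<noteq> 0" "t \<noteq> 0" "u \<noteq> 0" "v \<noteq> 0" using nz by (auto simp: d)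
  have "(1 + q^2*R1^2*L2 + q^2*R2*L1^2 - q^2*R2*L2 - 2*q*R1*L1) * (u^2*v*s^2*t) =
     u^2*v*s^2*t + q^2*(1-b)^2*(1-a)*(q-a)*u*t + q^2*(1-b)*(q-b)*(1-a)^2*v*s
       - q^2*(1-b)*(q-b)*(1-a)*(q-a)*u*s - 2*q*(1-b)*(1-a)*u*v*s*t"
    unfolding R1_def L1_def R2_def L2_def d[symmetric] using nz'
    by (simp add: field_simps power2_eq_square)
  also have "\<dots> = (1-a*b*q)^2*(1-a*b*q^2)*(1-q^2)*(1-q)^2"
    unfolding d by algebra
  finally show ?thesis unfolding d[symmetric] using nz' by (simp add: nonzero_eq_divide_eq)
qed

lemma one_minus_qvar_pow: "1 - qvar ^ n = (1 - qvar) * q_num n"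
  by (simp add: q_num_def)

lemma q_binom_add: "q_binom (k + d) k = q_fact (k + d) / (q_fact k * q_fact d)"
  by (simp add: q_binom_def)

lemma q_binom_add_swap: "q_binom (k + d) k = q_binom (d + k) d"
  using q_binom_add[of k d] q_binom_add[of d k] by (simp add: add.commute mult.commute)

lemma q_binom_shift1:
  "q_binom (k + d) k * ((1 - qvar^d) / (1 - qvar^k * qvar)) \<in> range to_fract"
proof (cases d)
  case 0
  thus ?thesis by (auto intro!: image_eqI[of _ _ 0])
next
  case (Suc e)
  have "1 - qvar^k * qvar = (1 - qvar) * q_num (Suc k)"
    using one_minus_qvar_pow[of "Suc k"] by (simp add: mult.commute)
  hence "q_binom (k + d) k * ((1 - qvar^d) / (1 - qvar^k * qvar)) = q_binom (Suc k + e) (Suc k)"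
    unfolding q_binom_add one_minus_qvar_pow using Suc by (simp add: divide_simps)
  thus ?thesis using q_binom_poly[of "Suc k" "Suc k + e"] by simp
qed

lemma q_binom_shift2:
  "q_binom (k + d) k * ((1 - qvar^d) * (qvar - qvar^d) /
     ((1 - qvar^k * qvar) * (1 - qvar^k * qvar^2))) \<in> range to_fract"
proof (cases "d = 0 \<or> d = 1")
  case True
  thus ?thesis by (auto intro!: image_eqI[of _ _ 0])
next
  case False
  then obtain e where d: "d = Suc (Suc e)"
    by (metis One_nat_def not0_implies_Suc)
  have 1: "1 - qvar^k * qvar = (1 - qvar) * q_num (Suc k)"
    using one_minus_qvar_pow[of "Suc k"] by (simp add: mult.commute)
  have 2: "1 - qvar^k * qvar^2 = (1 - qvar) * q_num (Suc (Suc k))"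
    using one_minus_qvar_pow[of "Suc (Suc k)"] by (simp add: power2_eq_square mult_ac)
  have 3: "qvar - qvar^d = qvar * ((1 - qvar) * q_num (Suc e))"
    unfolding one_minus_qvar_pow[symmetric] by (simp add: d algebra_simps)
  have "q_binom (k + d) k * ((1 - qvar^d) * (qvar - qvar^d) /
     ((1 - qvar^k * qvar) * (1 - qvar^k * qvar^2))) =
       qvar * q_binom (Suc (Suc k) + e) (Suc (Suc k))"
    unfolding q_binom_add 1 2 3 one_minus_qvar_pow[of d] using d by (simp add: divide_simps)
  moreover obtain p where "q_binom (Suc (Suc k) + e) (Suc (Suc k)) = to_fract p"
    using q_binom_poly[of "Suc (Suc k)" "Suc (Suc k) + e"] by auto
  ultimately have "q_binom (k + d) k * ((1 - qvar^d) * (qvar - qvar^d) /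
     ((1 - qvar^k * qvar) * (1 - qvar^k * qvar^2))) = to_fract ([:0, 1:] * p)"
    unfolding to_fract_mult qvar_def by simp
  thus ?thesis by blast
qed

lemma q_baxter_fract_poly:
  assumes "k \<le> n"
  shows "q_baxter_fract n k \<in> range to_fract"
proof -
  obtain d where n: "n = k + d" using assms le_Suc_ex by blast
  define q a b where defs: "q = qvar" "a = qvar ^ k" "b = qvar ^ d"
  define N where "N = q_binom (k + d) k"
  define R1 L1 where RL1: "R1 = (1-b)/(1-a*q)" "L1 = (1-a)/(1-b*q)"
  define R2 L2 where RL2: "R2 = (1-b)*(q-b)/((1-a*q)*(1-a*q^2))"
    "L2 = (1-a)*(q-a)/((1-b*q)*(1-b*q^2))"
  obtain p0 p1 p2 m1 m2 where p: "N = to_fract p0" "N * R1 = to_fract p1" "N * R2 = to_fract p2"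
      "N * L1 = to_fract m1" "N * L2 = to_fract m2"
    using q_binom_poly[of k "k + d"] q_binom_shift1[of k d] q_binom_shift2[of k d]
      q_binom_shift1[of d k] q_binom_shift2[of d k]
    unfolding N_def RL1 RL2 defs q_binom_add_swap[of d k] by auto
  have e1: "1 - a*q = (1-q) * q_num (Suc k)" "1 - b*q = (1-q) * q_num (Suc d)"
    using one_minus_qvar_pow[of "Suc k"] one_minus_qvar_pow[of "Suc d"]
    by (simp_all add: defs mult.commute)
  have e2: "1 - a*q^2 = (1-q) * q_num (Suc (Suc k))" "1 - b*q^2 = (1-q) * q_num (Suc (Suc d))"
    using one_minus_qvar_pow[of "Suc (Suc k)"] one_minus_qvar_pow[of "Suc (Suc d)"]
    by (simp_all add: defs mult_ac power2_eq_square)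
  have e3: "1 - a*b*q = (1-q) * q_num (Suc (k+d))" "1 - a*b*q^2 = (1-q) * q_num (Suc (Suc (k+d)))"
    using one_minus_qvar_pow[of "Suc (k+d)"] one_minus_qvar_pow[of "Suc (Suc (k+d))"]
    by (simp_all add: defs mult_ac power2_eq_square power_add)
  have e4: "1 - q^2 = (1-q) * q_num (Suc (Suc 0))"
    using one_minus_qvar_pow[of "Suc (Suc 0)"] by (simp add: defs power2_eq_square)
  have e5: "q_num (Suc 0) = 1" by (simp add: q_num_def)
  have q1: "1 - q \<noteq> 0" by (simp add: defs)
  have b0: "q_binom n k = N" by (simp add: N_def n)
  have b1: "q_binom (n + 1) k = N * q_num (Suc (k+d)) / q_num (Suc d)"
    using q_binom_add[of k "Suc d"] by (simp add: N_def n q_binom_add)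
  have b2: "q_binom (n + 2) k = N * q_num (Suc (k+d)) * q_num (Suc (Suc (k+d))) /
      (q_num (Suc d) * q_num (Suc (Suc d)))"
    using q_binom_add[of k "Suc (Suc d)"] by (simp add: N_def n q_binom_add)
  have c1: "q_binom (k + 1) k = q_num (Suc k)"
    using q_binom_add[of k 1] by (simp add: e5)
  have c2: "q_binom (k + 2) k = q_num (Suc k) * q_num (Suc (Suc k)) / q_num (Suc (Suc 0))"
    using q_binom_add[of k "Suc (Suc 0)"] by (simp add: e5)
  have "q_binom n k * q_binom (n + 1) k * q_binom (n + 2) k /
       (q_binom (k + 1) k * q_binom (k + 2) k) =
      N^3 * ((1-a*b*q)^2*(1-a*b*q^2)*(1-q^2)*(1-q)^2 /
        ((1-b*q)^2*(1-b*q^2)*(1-a*q)^2*(1-a*q^2)))"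
    unfolding b0 b1 b2 c1 c2 e1 e2 e3 e4 using q1
    by (simp add: divide_simps power2_eq_square power3_eq_cube)
  also have "\<dots> = N^3 * (1 + q^2*R1^2*L2 + q^2*R2*L1^2 - q^2*R2*L2 - 2*q*R1*L1)"
    unfolding RL1 RL2
    by (subst baxter_det_identity) (use q1 in \<open>auto simp: e1 e2\<close>)
  also have "\<dots> = N^3 + q^2*(N*R1)^2*(N*L2) + q^2*(N*R2)*(N*L1)^2 - q^2*N*(N*R2)*(N*L2)
      - (q+q)*N*(N*R1)*(N*L1)"
    by algebra
  also have "\<dots> = to_fract (p0^3 + [:0,1:]^2*p1^2*m2 + [:0,1:]^2*p2*m1^2 - [:0,1:]^2*p0*p2*m2
      - ([:0,1:]+[:0,1:])*p0*p1*m1)"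
    unfolding p(2-5) unfolding p(1) by (simp only: defs qvar_def to_fract_power to_fract_mult to_fract_add to_fract_diff)
  finally have "q_baxter_fract n k = to_fract ([:0, 1:] ^ (3 * k * (k - 1) div 2) *
      (p0^3 + [:0,1:]^2*p1^2*m2 + [:0,1:]^2*p2*m1^2 - [:0,1:]^2*p0*p2*m2
      - ([:0,1:]+[:0,1:])*p0*p1*m1))"
    unfolding q_baxter_fract_def to_fract_mult[of "_ ^ _"] to_fract_power
      qvar_def[symmetric] times_divide_eq_right[symmetric] by simp
  thus ?thesis by blast
qed

lemma to_fract_q_baxter:
  assumes "k \<le> n"
  shows "to_fract (q_baxter n k) = q_baxter_fract n k"
proof -
  obtain p where p: "q_baxter_fract n k = to_fract p"
    using q_baxter_fract_poly[OF assms] by auto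
  show ?thesis unfolding q_baxter_def p by simp
qed

end

theory Submission
  imports Defs "Jordan_Normal_Form.Determinant"
begin

text \<open>
  Write \<open>[m]!\<close> for the \<open>q\<close>-factorial and let
  \<open>M\<^sub>r(a, b) = \<Prod>j<r. [j]! [a + b + j]! / ([a + j]! [b + j]!)\<close>, which by MacMahon's theorem is
  the generating function of the plane partitions in an \<open>r \<times> a \<times> b\<close> box. Sorting the factorials
  in the Baxter number shows that, up to a power of \<open>q\<close>, it is \<open>M\<^sub>3(k, n - k)\<close>. Consecutive values
  differ by few factors, so \<open>M\<^sub>3(k, d)\<^sup>2 - M\<^sub>3(k, d - 1) M\<^sub>3(k, d + 1)\<close> is a single product
  times \<open>[k + d] [d + 3] - [k + d + 3] [d] = q\<^sup>d [k] [3]\<close>. The factorials regroup once more, now into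
  boxes of widths 4 and 2:

  \<open>M\<^sub>3(k, d)\<^sup>2 - M\<^sub>3(k, d - 1) M\<^sub>3(k, d + 1) = q\<^sup>d M\<^sub>4(k - 1, d) M\<^sub>2(k + 1, d)\<close>
  (\<open>macmahon_box_condensation\<close>).

  So everything reduces to the nonnegativity of \<open>M\<^sub>r(a, b)\<close>. Up to a power of \<open>q\<close> this is the Schur
  function of the rectangle with \<open>r\<close> columns of length \<open>a\<close>, evaluated at \<open>1, q, \<dots>, q^(a + b - 1)\<close>.
  The Schur functions of all shapes with at most \<open>r\<close> columns satisfy the branching rule: removing
  the last of \<open>N + 1\<close> variables means deleting at most one box from every column, with weight \<open>q^N\<close>
  per box. All weights are nonnegative, so induction on \<open>N\<close> gives the claim. The work lies in
  verifying the branching rule for the explicit product formula, a Vandermonde determinant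
  in the powers of \<open>1/q\<close> times one factor for each column (\<open>schur_spec_branching\<close>). Since each factor
  depends on its own column only, the sum over the sets of shortened columns collapses by
  multilinearity to one determinant, and this is the Vandermonde matrix times a bidiagonal one.

  Powers of \<open>q\<close> in front are harmless throughout: the defect is already known to be a
  polynomial, and multiplying it by a power of \<open>q\<close> only shifts its coefficients.
\<close>

unbundle no fps_syntax

section \<open>Determinants and alternants\<close>

lemma det_mat_Leibniz:
  "det (mat n n (\<lambda>(i, j). f i j)) =
     (\<Sum>p | p permutes {0..<n}. signof p * (\<Prod>i=0..<n. f i (p i)))"
  by (subst det_def'[of _ n])
     (auto intro!: sum.cong prod.cong arg_cong2[of _ _ _ _ "(*)"] simp: permutes_in_image)

lemma det_mat_scale_rows:
  fixes c :: "nat \<Rightarrow> 'a :: comm_ring_1"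
  shows "det (mat n n (\<lambda>(i, j). c i * f i j)) = (\<Prod>i<n. c i) * det (mat n n (\<lambda>(i, j). f i j))"
  unfolding det_mat_Leibniz sum_distrib_left
  by (intro sum.cong) (auto simp: prod.distrib lessThan_atLeast0 mult_ac)

lemma det_mat_scale_columns:
  fixes c :: "nat \<Rightarrow> 'a :: comm_ring_1"
  shows "det (mat n n (\<lambda>(i, j). c j * f i j)) = (\<Prod>j<n. c j) * det (mat n n (\<lambda>(i, j). f i j))"
  unfolding det_mat_Leibniz sum_distrib_left
proof (intro sum.cong refl)
  fix p assume "p \<in> {p. p permutes {0..<n}}"
  hence "(\<Prod>i=0..<n. c (p i)) = (\<Prod>j<n. c j)"
    using prod.permute[of p "{0..<n}" c] by (simp add: o_def lessThan_atLeast0)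
  thus "signof p * (\<Prod>i=0..<n. c (p i) * f i (p i)) =
      (\<Prod>j<n. c j) * (signof p * (\<Prod>i=0..<n. f i (p i)))"
    by (simp add: prod.distrib mult_ac)
qed

text \<open>
  Multilinearity in all rows at once. It is read from right to left below: a sum over all
  sets of modified rows becomes a single determinant.
\<close>

lemma det_mat_add_rows:
  fixes f g :: "nat \<Rightarrow> nat \<Rightarrow> 'a :: comm_ring_1"
  shows "det (mat n n (\<lambda>(i, j). f i j + g i j)) =
    (\<Sum>S\<in>Pow {..<n}. det (mat n n (\<lambda>(i, j). if i \<in> S then g i j else f i j)))"
proof -
  have "(\<Prod>i=0..<n. f i (p i) + g i (p i)) =
      (\<Sum>S\<in>Pow {..<n}. \<Prod>i=0..<n. if i \<in> S then g i (p i) else f i (p i))" for p :: "nat \<Rightarrow> nat"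
  proof -
    have "(\<Prod>i=0..<n. f i (p i) + g i (p i)) =
      (\<Sum>S\<in>Pow {..<n}. (\<Prod>i\<in>S. g i (p i)) * (\<Prod>i\<in>{..<n} - S. f i (p i)))"
      using prod_add[of "{..<n}" "\<lambda>i. g i (p i)" "\<lambda>i. f i (p i)"]
      by (simp add: add.commute lessThan_atLeast0)
    also have "\<dots> = (\<Sum>S\<in>Pow {..<n}. \<Prod>i=0..<n. if i \<in> S then g i (p i) else f i (p i))"
    proof (intro sum.cong refl)
      fix S assume "S \<in> Pow {..<n}"
      hence "{0..<n} \<inter> S = S" "{0..<n} \<inter> - S = {..<n} - S" by auto
      thus "(\<Prod>i\<in>S. g i (p i)) * (\<Prod>i\<in>{..<n} - S. f i (p i)) =
          (\<Prod>i=0..<n. if i \<in> S then g i (p i) else f i (p i))"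
        using prod.If_cases[of "{0..<n}" "\<lambda>i. i \<in> S" "\<lambda>i. g i (p i)" "\<lambda>i. f i (p i)"] by simp
    qed
    finally show ?thesis .
  qed
  thus ?thesis
    unfolding det_mat_Leibniz by (simp add: sum_distrib_left) (rule sum.swap)
qed

definition vandermonde_det :: "nat \<Rightarrow> (nat \<Rightarrow> 'a :: comm_ring_1) \<Rightarrow> 'a" where
  "vandermonde_det r x = det (mat r r (\<lambda>(i, j). x i ^ j))"

lemma vandermonde_det_cong:
  "(\<And>i. i < r \<Longrightarrow> x i = y i) \<Longrightarrow> vandermonde_det r x = vandermonde_det r y"
  unfolding vandermonde_det_def by (intro arg_cong[of _ _ det] eq_matI) auto

lemma vandermonde_det_scale:
  "vandermonde_det r (\<lambda>i. c * x i) = (\<Prod>j<r. c ^ j) * vandermonde_det r x"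
proof -
  have "mat r r (\<lambda>(i, j). (c * x i) ^ j) = mat r r (\<lambda>(i, j). c ^ j * x i ^ j)"
    by (rule eq_matI) (auto simp: power_mult_distrib)
  thus ?thesis by (simp only: vandermonde_det_def det_mat_scale_columns)
qed

lemma vandermonde_det_eq_0:
  assumes "i < r" "j < r" "i \<noteq> j" "x i = x j"
  shows "vandermonde_det r x = 0"
  unfolding vandermonde_det_def
  by (rule det_identical_rows[of _ r i j]) (use assms in \<open>auto intro!: eq_vecI\<close>)

text \<open>
  A vector in the kernel of the Vandermonde matrix is the coefficient vector of a nonzero
  polynomial of degree less than \<open>r\<close> that vanishes at \<open>r\<close> points.
\<close>

lemma vandermonde_det_nonzero:
  fixes x :: "nat \<Rightarrow> 'a :: field"
  assumes inj: "inj_on x {..<r}"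
  shows "vandermonde_det r x \<noteq> 0"
proof
  let ?A = "mat r r (\<lambda>(i, j). x i ^ j)"
  assume "vandermonde_det r x = 0"
  then obtain v where v: "v \<in> carrier_vec r" "v \<noteq> 0\<^sub>v r" "?A *\<^sub>v v = 0\<^sub>v r"
    using det_0_iff_vec_prod_zero_field[of ?A r] by (auto simp: vandermonde_det_def)
  define p where "p = (\<Sum>j<r. monom (v $ j) j)"
  have coeff_p: "coeff p j = (if j < r then v $ j else 0)" for j
    by (simp add: p_def coeff_sum coeff_monom)
  have "\<exists>j<r. v $ j \<noteq> 0"
  proof (rule ccontr)
    assume "\<not> (\<exists>j<r. v $ j \<noteq> 0)"
    hence "v = 0\<^sub>v r" using v(1) by (intro eq_vecI) auto
    thus False using v(2) by contradiction
  qed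
  then obtain j where j: "j < r" "v $ j \<noteq> 0" by blast
  hence "p \<noteq> 0" using coeff_p[of j] by auto
  have "degree p \<le> r - 1"
    by (rule degree_le) (auto simp: coeff_p)
  hence "degree p < r" using j by simp
  have "poly p (x i) = 0" if "i < r" for i
  proof -
    have "poly p (x i) = (\<Sum>j<r. x i ^ j * v $ j)"
      by (simp add: p_def poly_sum poly_monom mult.commute)
    also have "\<dots> = (?A *\<^sub>v v) $ i"
      using that v(1) by (simp add: scalar_prod_def lessThan_atLeast0)
    also have "\<dots> = 0" unfolding v(3) using that by simp
    finally show ?thesis .
  qed
  hence "x ` {..<r} \<subseteq> {z. poly p z = 0}" by auto
  hence "card (x ` {..<r}) \<le> degree p"
    by (rule order_trans[OF card_mono[OF poly_roots_finite[OF \<open>p \<noteq> 0\<close>]]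
          card_poly_roots_bound[OF \<open>p \<noteq> 0\<close>]])
  thus False using \<open>degree p < r\<close> by (simp add: card_image[OF inj])
qed

text \<open>
  The matrix is the Vandermonde matrix times a lower bidiagonal matrix with diagonal \<open>u\<close>. The
  condition on \<open>t\<close> keeps the power \<open>x i ^ r\<close>, for which there is no column, out of the last column.
\<close>

lemma det_bidiagonal_alternant:
  fixes x :: "nat \<Rightarrow> 'a :: comm_ring_1"
  assumes "t (r - 1) = 0"
  shows "det (mat r r (\<lambda>(i, k). u k * x i ^ k + t k * x i ^ Suc k)) =
           (\<Prod>k<r. u k) * vandermonde_det r x"
proof -
  define V where "V = mat r r (\<lambda>(i, j). x i ^ j)"
  define T where "T = mat r r (\<lambda>(j, k). if j = k then u k else if j = Suc k then t k else 0)"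
  have "(\<Sum>j = 0..<r. x i ^ j * (if j = k then u k else if j = Suc k then t k else 0)) =
      u k * x i ^ k + t k * x i ^ Suc k" if ik: "i < r" "k < r" for i k
  proof -
    have "(\<Sum>j = 0..<r. x i ^ j * (if j = k then u k else if j = Suc k then t k else 0)) =
      (\<Sum>j = 0..<r. (if j = k then x i ^ k * u k else 0) + (if j = Suc k then x i ^ Suc k * t k else 0))"
      by (intro sum.cong) auto
    also have "\<dots> = x i ^ k * u k + (if Suc k < r then x i ^ Suc k * t k else 0)"
      using ik by (simp add: sum.distrib)
    also have "(if Suc k < r then x i ^ Suc k * t k else 0) = x i ^ Suc k * t k"
    proof (cases "Suc k < r")
      case False
      hence "k = r - 1" using ik by simp
      thus ?thesis using assms by simp
    qed simp
    finally show ?thesis by (simp add: mult_ac)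
  qed
  moreover have "(V * T) $$ (i, k) =
      (\<Sum>j = 0..<r. x i ^ j * (if j = k then u k else if j = Suc k then t k else 0))"
    if "i < r" "k < r" for i k
    using that by (simp add: V_def T_def scalar_prod_def)
  ultimately have "mat r r (\<lambda>(i, k). u k * x i ^ k + t k * x i ^ Suc k) = V * T"
    by (intro eq_matI) (simp_all add: V_def T_def)
  moreover have "det T = (\<Prod>k<r. u k)"
    by (subst det_lower_triangular[of r])
       (auto simp: T_def prod_list_diag_prod lessThan_atLeast0)
  ultimately show ?thesis
    using det_mult[of V r T] by (simp add: V_def T_def vandermonde_det_def mult.commute)
qed

section \<open>Nonnegative coefficients\<close>

text \<open>
  The predicate lives in the field of fractions, where the product formulas are stated; it
  includes the claim that the fraction is a polynomial.
\<close>

definition nonneg_coeffs :: "real poly fract \<Rightarrow> bool" where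
  "nonneg_coeffs x \<longleftrightarrow> (\<exists>p. x = to_fract p \<and> (\<forall>i. 0 \<le> coeff p i))"

lemma nonneg_coeffs_0 [simp]: "nonneg_coeffs 0"
  unfolding nonneg_coeffs_def by (intro exI[of _ 0]) auto

lemma nonneg_coeffs_1 [simp]: "nonneg_coeffs 1"
  unfolding nonneg_coeffs_def by (intro exI[of _ 1]) auto

lemma nonneg_coeffs_qvar [simp]: "nonneg_coeffs qvar"
  unfolding nonneg_coeffs_def qvar_def
  by (intro exI[of _ "[:0, 1:]"]) (auto simp: coeff_pCons split: nat.split)

lemma nonneg_coeffs_add: "nonneg_coeffs x \<Longrightarrow> nonneg_coeffs y \<Longrightarrow> nonneg_coeffs (x + y)"
  unfolding nonneg_coeffs_def by (metis add_nonneg_nonneg coeff_add to_fract_add)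

lemma nonneg_coeffs_mult:
  assumes "nonneg_coeffs x" "nonneg_coeffs y"
  shows "nonneg_coeffs (x * y)"
proof -
  obtain p s where "x = to_fract p" "y = to_fract s"
      and "\<forall>i. 0 \<le> coeff p i" "\<forall>i. 0 \<le> coeff s i"
    using assms unfolding nonneg_coeffs_def by auto
  thus ?thesis unfolding nonneg_coeffs_def
    by (intro exI[of _ "p * s"]) (auto simp: coeff_mult intro!: sum_nonneg)
qed

lemma nonneg_coeffs_prod:
  "(\<And>i. i \<in> A \<Longrightarrow> nonneg_coeffs (f i)) \<Longrightarrow> nonneg_coeffs (prod f A)"
  by (induction A rule: infinite_finite_induct) (auto intro: nonneg_coeffs_mult)

lemma nonneg_coeffs_sum:
  "(\<And>i. i \<in> A \<Longrightarrow> nonneg_coeffs (f i)) \<Longrightarrow> nonneg_coeffs (sum f A)"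
  by (induction A rule: infinite_finite_induct) (auto intro: nonneg_coeffs_add)

lemma nonneg_coeffs_qvar_power [simp]: "nonneg_coeffs (qvar ^ n)"
  by (induction n) (auto intro: nonneg_coeffs_mult)

lemma coeff_nonneg_if_qvar_power_mult:
  assumes "nonneg_coeffs (qvar ^ e * to_fract p)"
  shows "0 \<le> coeff p i"
proof -
  have "qvar ^ e * to_fract p = to_fract (monom 1 e * p)"
    by (simp add: qvar_def to_fract_power[symmetric] monom_altdef)
  then obtain s where s: "to_fract (monom 1 e * p) = to_fract s" "\<forall>i. 0 \<le> coeff s i"
    using assms unfolding nonneg_coeffs_def by auto
  hence "coeff s (e + i) = coeff p i"
    by (simp add: coeff_monom_mult flip: s(1)[unfolded to_fract_eq_iff])
  thus ?thesis using s(2) by metis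
qed

section \<open>Principal specializations of Schur functions\<close>

text \<open>
  This is the elementary symmetric polynomial of degree \<open>y\<close> at \<open>1, q, \<dots>, q^(m - 1)\<close>, divided by
  the \<open>q\<close>-factorial of \<open>m\<close>. The value 0 for \<open>y > m\<close> keeps the recurrences in \<open>m\<close> below valid for
  all \<open>y\<close>, in particular at \<open>y = Suc m\<close>, where \<open>q_num (Suc m - y)\<close> vanishes.
\<close>

definition elem_sym_over_fact :: "nat \<Rightarrow> nat \<Rightarrow> real poly fract" where
  "elem_sym_over_fact m y = (if y \<le> m then qvar ^ (y choose 2) / (q_fact y * q_fact (m - y)) else 0)"

text \<open>
  Up to the constant power \<open>q ^ (\<Sum>i<r. i choose 2)\<close>, this is the Schur function at
  \<open>1, q, \<dots>, q^(N - 1)\<close> of the shape with \<open>r\<close> columns of lengths \<open>y i - i\<close>, for increasing \<open>y\<close>. The shift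
  by \<open>i\<close> makes the columns distinct numbers, so that the hook product turns into a Vandermonde
  determinant in the powers \<open>q ^ (- y i)\<close>. Dividing by its value at the empty shape, \<open>y i = i\<close>,
  normalizes it.
\<close>

definition schur_spec :: "nat \<Rightarrow> nat \<Rightarrow> (nat \<Rightarrow> nat) \<Rightarrow> real poly fract" where
  "schur_spec r N y =
     (\<Prod>k<r. q_fact k * q_fact (N + k)) * (\<Prod>i<r. elem_sym_over_fact (N + r - 1) (y i)) *
     vandermonde_det r (\<lambda>i. inverse qvar ^ y i) / vandermonde_det r (\<lambda>i. inverse qvar ^ i)"

lemma vandermonde_det_qvar_nonzero: "vandermonde_det r (\<lambda>i. inverse qvar ^ i) \<noteq> 0"
proof (rule vandermonde_det_nonzero, rule linorder_inj_onI)
  fix i j :: nat assume "i < j"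
  thus "inverse qvar ^ i \<noteq> inverse qvar ^ j"
    using qvar_power_eq_1_iff[of "j - i"] by (auto simp: power_inverse power_diff)
qed auto

lemma elem_sym_over_fact_Suc_left: "elem_sym_over_fact m y = q_num (Suc m - y) * elem_sym_over_fact (Suc m) y"
  by (auto simp: elem_sym_over_fact_def Suc_diff_le le_Suc_eq)

lemma elem_sym_over_fact_Suc_right:
  "qvar ^ y * elem_sym_over_fact m y = q_num (Suc y) * elem_sym_over_fact (Suc m) (Suc y)"
proof -
  have "Suc y choose 2 = y + (y choose 2)"
    by (simp add: numeral_2_eq_2)
  thus ?thesis by (auto simp: elem_sym_over_fact_def power_add)
qed

text \<open>
  Both sides are \<open>1 + q^(N + 1 + k - y) - q^(M - y) - q^(N + 1 + k)\<close>, divided by \<open>1 - q\<close>.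
\<close>

lemma q_num_complement_identity:
  assumes "y \<le> M" "y > 0"
  shows "q_num (M - y) + qvar ^ (N + k) * inverse qvar ^ (y - 1) * q_num y =
    q_num (N + 1 + k) + (qvar ^ (N + 1 + k) - qvar ^ M) / (1 - qvar) * inverse qvar ^ y"
proof -
  obtain d z where d: "M = y + d" "y = Suc z" using assms by (metis gr0_implies_Suc le_Suc_ex)
  define X where "X = qvar ^ z"
  have X: "X \<noteq> 0" "inverse qvar ^ z = inverse X" by (auto simp: X_def power_inverse)
  show ?thesis using X unfolding q_num_def d
    by (simp add: power_add X_def[symmetric] divide_simps) (simp add: algebra_simps)
qed

text \<open>
  One row of the determinant behind the branching rule: either column \<open>y\<close> stays as it is or it
  loses a box, which cannot happen for \<open>y = 0\<close>. In terms of \<open>w = q ^ (- y)\<close> the sum of both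
  possibilities combines just two consecutive powers of \<open>w\<close>, with coefficients that do not
  depend on \<open>y\<close>. The higher coefficient vanishes for \<open>k = r - 1\<close>, as \<open>N + 1 + k = Suc m\<close> then.
\<close>

lemma schur_row_identity:
  fixes N r k y :: nat
  assumes "k < r"
  defines "m \<equiv> N + r - 1"
  shows "elem_sym_over_fact m y * (inverse qvar ^ y) ^ k +
     (if y = 0 then 0 else qvar ^ N * elem_sym_over_fact m (y - 1) * (inverse qvar ^ (y - 1)) ^ k) =
     elem_sym_over_fact (Suc m) y * (q_num (N + 1 + k) * (inverse qvar ^ y) ^ k +
       (qvar ^ (N + 1 + k) - qvar ^ Suc m) / (1 - qvar) * (inverse qvar ^ y) ^ Suc k)"
proof (cases "y = 0")
  case True
  have "q_num (Suc m) = q_num (N + 1 + k) + (qvar ^ (N + 1 + k) - qvar ^ Suc m) / (1 - qvar)"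
    by (simp add: q_num_def diff_divide_distrib)
  thus ?thesis using True by (simp add: elem_sym_over_fact_Suc_left[of m] mult.commute)
next
  case False
  then obtain z where z: "y = Suc z" by (metis not0_implies_Suc)
  define w where "w = inverse qvar ^ y"
  show ?thesis
  proof (cases "y \<le> Suc m")
    case True
    have sh: "elem_sym_over_fact m z = inverse qvar ^ z * q_num y * elem_sym_over_fact (Suc m) y"
      using elem_sym_over_fact_Suc_right[of z m] unfolding z by (simp add: field_simps power_inverse)
    have wz: "(inverse qvar ^ z) ^ k = qvar ^ k * w ^ k"
      unfolding w_def z by (simp add: power_mult_distrib power_inverse field_simps)
    have "elem_sym_over_fact m y * w ^ k + qvar ^ N * elem_sym_over_fact m z * (inverse qvar ^ z) ^ k =
      elem_sym_over_fact (Suc m) y * w ^ k *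
        (q_num (Suc m - y) + qvar ^ (N + k) * inverse qvar ^ (y - 1) * q_num y)"
      unfolding sh wz elem_sym_over_fact_Suc_left[of m y] by (simp add: z power_add algebra_simps)
    also have "\<dots> = elem_sym_over_fact (Suc m) y * w ^ k *
        (q_num (N + 1 + k) + (qvar ^ (N + 1 + k) - qvar ^ Suc m) / (1 - qvar) * w)"
      unfolding w_def by (subst q_num_complement_identity) (use True False in auto)
    finally show ?thesis using False unfolding w_def[symmetric] by (simp add: z algebra_simps)
  qed (use z in \<open>simp add: elem_sym_over_fact_def\<close>)
qed

text \<open>
  The branching rule of Schur functions: \<open>S\<close> is the set of columns that lose a box when the
  variable \<open>q ^ N\<close> is removed. Sets that do not lead to a shape either have \<open>y i = 0\<close> for a column
  in \<open>S\<close> or produce two equal columns, in which case the determinant vanishes by itself.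
\<close>

lemma schur_spec_branching:
  assumes "r > 0"
  shows "schur_spec r (Suc N) y = (\<Sum>S\<in>Pow {..<r}.
    if \<exists>i\<in>S. y i = 0 then 0
    else qvar ^ (N * card S) * schur_spec r N (\<lambda>i. if i \<in> S then y i - 1 else y i))"
proof -
  define m where "m = N + r - 1"
  define C where "C = (\<Prod>k<r. q_fact k * q_fact (N + k))"
  define V0 where "V0 = vandermonde_det r (\<lambda>i. inverse qvar ^ i)"
  define f where "f = (\<lambda>i k. elem_sym_over_fact m (y i) * (inverse qvar ^ y i) ^ k)"
  define g where "g = (\<lambda>i k. if y i = 0 then 0 else
     qvar ^ N * elem_sym_over_fact m (y i - 1) * (inverse qvar ^ (y i - 1)) ^ k)"
  define y' where "y' = (\<lambda>S i. if i \<in> S then y i - 1 else y i)"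
  have m: "Suc N + r - 1 = Suc m" "N + r - 1 = m" using assms by (auto simp: m_def)
  have summand: "C * det (mat r r (\<lambda>(i, k). if i \<in> S then g i k else f i k)) / V0 =
      (if \<exists>i\<in>S. y i = 0 then 0 else qvar ^ (N * card S) * schur_spec r N (y' S))"
    if S: "S \<in> Pow {..<r}" for S
  proof -
    \<comment> \<open>The factor that row \<open>i\<close> contributes besides its own term of the product formula.\<close>
    define c where "c = (\<lambda>i. if i \<in> S then if y i = 0 then 0 else qvar ^ N else 1)"
    have "mat r r (\<lambda>(i, k). if i \<in> S then g i k else f i k) =
        mat r r (\<lambda>(i, k). (c i * elem_sym_over_fact m (y' S i)) * (inverse qvar ^ y' S i) ^ k)"
      by (rule eq_matI) (auto simp: c_def f_def g_def y'_def)
    hence "det (mat r r (\<lambda>(i, k). if i \<in> S then g i k else f i k)) =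
        (\<Prod>i<r. c i) * (\<Prod>i<r. elem_sym_over_fact m (y' S i)) *
        vandermonde_det r (\<lambda>i. inverse qvar ^ y' S i)"
      by (simp only: det_mat_scale_rows vandermonde_det_def prod.distrib)
    moreover have "(\<Prod>i<r. c i) = (if \<exists>i\<in>S. y i = 0 then 0 else qvar ^ (N * card S))"
    proof (cases "\<exists>i\<in>S. y i = 0")
      case True
      thus ?thesis using S by (auto simp: c_def intro!: prod_zero)
    next
      case False
      hence "(\<Prod>i<r. c i) = (\<Prod>i\<in>S. qvar ^ N)"
        using S by (intro prod.mono_neutral_cong_right) (auto simp: c_def)
      thus ?thesis using False by (simp add: power_mult)
    qed
    ultimately show ?thesis
      unfolding schur_spec_def m C_def[symmetric] V0_def[symmetric] by (auto simp: mult_ac)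
  qed
  have "(\<Sum>S\<in>Pow {..<r}. C * det (mat r r (\<lambda>(i, k). if i \<in> S then g i k else f i k)) / V0) =
      C * det (mat r r (\<lambda>(i, k). f i k + g i k)) / V0"
    by (simp add: det_mat_add_rows sum_distrib_left sum_divide_distrib)
  also have "mat r r (\<lambda>(i, k). f i k + g i k) =
     mat r r (\<lambda>(i, k). elem_sym_over_fact (Suc m) (y i) * (q_num (N + 1 + k) * (inverse qvar ^ y i) ^ k +
       (qvar ^ (N + 1 + k) - qvar ^ Suc m) / (1 - qvar) * (inverse qvar ^ y i) ^ Suc k))"
    (is "_ = mat r r ?h")
  proof -
    have "f i k + g i k = ?h (i, k)" if "k < r" for i k
      using schur_row_identity[OF that] unfolding f_def g_def m_def prod.case .
    thus ?thesis
      by (intro eq_matI) (simp_all only: index_mat dim_row_mat dim_col_mat prod.case)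
  qed
  also have "det \<dots> = (\<Prod>i<r. elem_sym_over_fact (Suc m) (y i)) *
      ((\<Prod>k<r. q_num (N + 1 + k)) * vandermonde_det r (\<lambda>i. inverse qvar ^ y i))"
    by (simp only: det_mat_scale_rows)
       (subst det_bidiagonal_alternant, use assms in \<open>auto simp: m_def\<close>)
  also have "C * \<dots> / V0 = schur_spec r (Suc N) y"
    unfolding schur_spec_def m C_def V0_def by (simp add: prod.distrib mult_ac)
  finally have "schur_spec r (Suc N) y =
    (\<Sum>S\<in>Pow {..<r}. C * det (mat r r (\<lambda>(i, k). if i \<in> S then g i k else f i k)) / V0)" ..
  also have "\<dots> = (\<Sum>S\<in>Pow {..<r}.
      if \<exists>i\<in>S. y i = 0 then 0 else qvar ^ (N * card S) * schur_spec r N (y' S))"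
    by (rule sum.cong[OF refl summand])
  finally show ?thesis unfolding y'_def .
qed

text \<open>
  Induction along the branching rule. Without variables, only the empty shape contributes:
  for any other the last column is so long that the factor attached to it is 0.
\<close>

lemma nonneg_coeffs_schur_spec:
  assumes "r > 0" "strict_mono_on {..<r} y"
  shows "nonneg_coeffs (schur_spec r N y)"
  using assms(2)
proof (induction N arbitrary: y)
  case 0
  have ge: "i \<le> y i" if "i < r" for i
    using that
  proof (induction i)
    case (Suc i)
    thus ?case using strict_mono_onD[OF 0, of i "Suc i"] by simp
  qed simp
  show ?case
  proof (cases "\<forall>i<r. y i = i")
    case True
    define V0 where "V0 = vandermonde_det r (\<lambda>i. inverse qvar ^ i)"
    have "V0 \<noteq> 0" unfolding V0_def by (rule vandermonde_det_qvar_nonzero)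
    moreover have "vandermonde_det r (\<lambda>i. inverse qvar ^ y i) = V0"
      unfolding V0_def using True by (intro vandermonde_det_cong) auto
    ultimately have "schur_spec r 0 y =
      (\<Prod>k<r. q_fact k * q_fact k) * (\<Prod>i<r. elem_sym_over_fact (r - 1) i)"
      using True unfolding schur_spec_def V0_def[symmetric] by simp
    also have "(\<Prod>i<r. elem_sym_over_fact (r - 1) i) =
      (\<Prod>i<r. qvar ^ (i choose 2)) / ((\<Prod>i<r. q_fact i) * (\<Prod>i<r. q_fact (r - Suc i)))"
      unfolding prod.distrib[symmetric] prod_dividef[symmetric]
      by (intro prod.cong) (auto simp: elem_sym_over_fact_def)
    also have "(\<Prod>i<r. q_fact (r - Suc i)) = (\<Prod>i<r. q_fact i)"
      by (rule prod.nat_diff_reindex)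
    also have "(\<Prod>k<r. q_fact k * q_fact k) *
        ((\<Prod>i<r. qvar ^ (i choose 2)) / ((\<Prod>i<r. q_fact i) * (\<Prod>i<r. q_fact i))) =
        (\<Prod>i<r. qvar ^ (i choose 2))"
      by (simp add: prod.distrib)
    finally show ?thesis by (auto intro!: nonneg_coeffs_prod)
  next
    case False
    then obtain i where i: "i < r" "i < y i" using ge by (metis le_neq_implies_less)
    have "i + j < r \<Longrightarrow> i + j < y (i + j)" for j
    proof (induction j)
      case (Suc j)
      thus ?case using strict_mono_onD[OF 0, of "i + j" "i + Suc j"] by simp
    qed (use i in auto)
    \<comment> \<open>Once above the diagonal, a strictly increasing sequence stays above it up to the last index.\<close>
    from this[of "r - 1 - i"] have "y (r - 1) > r - 1" using i by simp
    hence "elem_sym_over_fact (0 + r - 1) (y (r - 1)) = 0" by (simp add: elem_sym_over_fact_def)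
    hence "(\<Prod>i<r. elem_sym_over_fact (0 + r - 1) (y i)) = 0"
      using \<open>r > 0\<close> by (intro prod_zero) (auto intro!: bexI[of _ "r - 1"])
    thus ?thesis
      unfolding schur_spec_def by (simp only: mult_zero_right mult_zero_left div_0 nonneg_coeffs_0)
  qed
next
  case (Suc N)
  show ?case unfolding schur_spec_branching[OF \<open>r > 0\<close>]
  proof (intro nonneg_coeffs_sum)
    fix S assume S: "S \<in> Pow {..<r}"
    define y' where "y' = (\<lambda>i. if i \<in> S then y i - 1 else y i)"
    \<comment> \<open>Shortening keeps the columns in weak order, so \<open>y'\<close> is either strict or not injective.\<close>
    have "nonneg_coeffs (schur_spec r N y')" if pos: "\<forall>i\<in>S. y i > 0"
    proof (cases "inj_on y' {..<r}")
      case True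
      have "strict_mono_on {..<r} y'"
      proof (rule strict_mono_onI)
        fix i j assume ij: "i \<in> {..<r}" "j \<in> {..<r}" "i < j"
        have "y i < y j" using strict_mono_onD[OF Suc.prems] ij by blast
        hence "y' i \<le> y' j" using pos by (auto simp: y'_def)
        moreover have "y' i \<noteq> y' j" using True ij by (auto dest: inj_onD)
        ultimately show "y' i < y' j" by simp
      qed
      thus ?thesis by (rule Suc.IH)
    next
      case False
      then obtain i j where "i < r" "j < r" "i \<noteq> j" "y' i = y' j"
        by (auto simp: inj_on_def)
      hence "vandermonde_det r (\<lambda>i. inverse qvar ^ y' i) = 0"
        by (intro vandermonde_det_eq_0[of i r j]) auto
      thus ?thesis unfolding schur_spec_def by simp
    qed
    thus "nonneg_coeffs (if \<exists>i\<in>S. y i = 0 then 0 else qvar ^ (N * card S) *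
        schur_spec r N (\<lambda>i. if i \<in> S then y i - 1 else y i))"
      unfolding y'_def by (auto intro!: nonneg_coeffs_mult)
  qed
qed

section \<open>The box formula of MacMahon\<close>

definition macmahon_box :: "nat \<Rightarrow> nat \<Rightarrow> nat \<Rightarrow> real poly fract" where
  "macmahon_box r a b =
     (\<Prod>j<r. q_fact j * q_fact (a + b + j) / (q_fact (a + j) * q_fact (b + j)))"

text \<open>
  The rectangle with \<open>r\<close> columns of length \<open>a\<close> has \<open>y i = a + i\<close>. Its Vandermonde determinant is that
  of the empty shape with all nodes scaled by \<open>q ^ (- a)\<close>, so the quotient of the two is
  a power of \<open>q\<close>, and only the factorials are left.
\<close>

lemma nonneg_coeffs_macmahon_box:
  assumes "r > 0"
  shows "\<exists>e. nonneg_coeffs (qvar ^ e * macmahon_box r a b)"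
proof -
  define V0 where "V0 = vandermonde_det r (\<lambda>i. inverse qvar ^ i)"
  have V0: "V0 \<noteq> 0" unfolding V0_def by (rule vandermonde_det_qvar_nonzero)
  have V: "vandermonde_det r (\<lambda>i. inverse qvar ^ (a + i)) = V0 / (\<Prod>j<r. (qvar ^ a) ^ j)"
  proof -
    have "(\<Prod>j<r. (inverse qvar ^ a) ^ j) = inverse (\<Prod>j<r. (qvar ^ a) ^ j)"
      by (simp add: power_inverse prod_inversef[symmetric] o_def)
    thus ?thesis
      unfolding power_add vandermonde_det_scale V0_def by (simp add: divide_inverse)
  qed
  have "(\<Prod>i<r. elem_sym_over_fact (a + b + r - 1) (a + i)) =
      (\<Prod>i<r. qvar ^ (a + i choose 2)) / ((\<Prod>i<r. q_fact (a + i)) * (\<Prod>i<r. q_fact (b + (r - Suc i))))"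
    unfolding prod.distrib[symmetric] prod_dividef[symmetric]
    by (intro prod.cong) (auto simp: elem_sym_over_fact_def intro!: arg_cong[of _ _ q_fact])
  also have "(\<Prod>i<r. q_fact (b + (r - Suc i))) = (\<Prod>i<r. q_fact (b + i))"
    by (rule prod.nat_diff_reindex)
  finally have h: "(\<Prod>i<r. elem_sym_over_fact (a + b + r - 1) (a + i)) =
    (\<Prod>i<r. qvar ^ (a + i choose 2)) / ((\<Prod>i<r. q_fact (a + i)) * (\<Prod>i<r. q_fact (b + i)))" .
  have "(\<Prod>j<r. (qvar ^ a) ^ j) * schur_spec r (a + b) (\<lambda>i. a + i) =
      (\<Prod>i<r. qvar ^ (a + i choose 2)) * macmahon_box r a b"
    unfolding schur_spec_def h V V0_def[symmetric] macmahon_box_def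
    using V0 by (simp add: prod_dividef prod.distrib)
  also have "(\<Prod>i<r. qvar ^ (a + i choose 2)) = qvar ^ (\<Sum>i<r. a + i choose 2)"
    by (simp add: power_sum)
  finally have "nonneg_coeffs (qvar ^ (\<Sum>i<r. a + i choose 2) * macmahon_box r a b)"
    using nonneg_coeffs_schur_spec[OF assms, of "\<lambda>i. a + i" "a + b"]
    by (metis (no_types, lifting) add_strict_left_mono nonneg_coeffs_mult nonneg_coeffs_prod
          nonneg_coeffs_qvar_power power_mult strict_mono_onI)
  thus ?thesis by blast
qed

section \<open>Baxter numbers\<close>

text \<open>
  The two \<open>q\<close>-binomials in the denominator of the Baxter number turn \<open>[k]! [k]! [k]!\<close> into
  \<open>[k]! [k + 1]! [k + 2]!\<close> up to the constant \<open>[1]! [2]!\<close>.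
\<close>

lemma q_baxter_fract_eq_macmahon_box:
  "q_baxter_fract (k + d) k = qvar ^ (3 * k * (k - 1) div 2) * macmahon_box 3 k d"
proof -
  have binoms: "q_binom (k + d) k = q_fact (k + d) / (q_fact k * q_fact d)"
    "q_binom (k + d + 1) k = q_fact (k + d + 1) / (q_fact k * q_fact (d + 1))"
    "q_binom (k + d + 2) k = q_fact (k + d + 2) / (q_fact k * q_fact (d + 2))"
    "q_binom (k + 1) k = q_fact (k + 1) / (q_fact k * q_fact 1)"
    "q_binom (k + 2) k = q_fact (k + 2) / (q_fact k * q_fact 2)"
    unfolding add.assoc by (rule q_binom_add)+
  have box: "macmahon_box 3 k d =
      (q_fact 1 * q_fact 2 * q_fact (k + d) * q_fact (k + d + 1) * q_fact (k + d + 2)) /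
      (q_fact k * q_fact (k + 1) * q_fact (k + 2) * q_fact d * q_fact (d + 1) * q_fact (d + 2))"
    by (simp add: macmahon_box_def numeral_3_eq_3 numeral_2_eq_2 lessThan_Suc mult_ac del: q_fact_Suc)
  show ?thesis
    unfolding q_baxter_fract_def binoms box by (simp add: divide_simps mult_ac del: q_fact_Suc)
qed

text \<open>
  All three boxes of width 3 are, up to few factors, the same product. Extracting it leaves
  the difference \<open>[n] [c + 4] - [n + 3] [c + 1]\<close> with \<open>n = a + c + 2\<close>, and this factors as
  \<open>q ^ (c + 1) [a + 1] [3]\<close>.
\<close>

lemma macmahon_box_condensation:
  "(macmahon_box 3 (Suc a) (Suc c))\<^sup>2 - macmahon_box 3 (Suc a) c * macmahon_box 3 (Suc a) (Suc (Suc c)) =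
     qvar ^ Suc c * macmahon_box 4 a (Suc c) * macmahon_box 2 (Suc (Suc a)) (Suc c)"
proof -
  let ?n = "Suc a + Suc c"
  define M where "M = (macmahon_box 3 (Suc a) (Suc c))\<^sup>2"
  define u where "u = q_num ?n * q_num (c + 4)"
  have u: "u \<noteq> 0" by (simp add: u_def)
  note unfold_box = macmahon_box_def numeral_2_eq_2 numeral_3_eq_3 eval_nat_numeral lessThan_Suc
  have 1: "macmahon_box 3 (Suc a) c * macmahon_box 3 (Suc a) (Suc (Suc c)) * u =
      M * (q_num (?n + 3) * q_num (Suc c))"
    unfolding M_def u_def by (simp add: unfold_box divide_simps)
  have 2: "macmahon_box 4 a (Suc c) * macmahon_box 2 (Suc (Suc a)) (Suc c) * u =
      M * (q_num (Suc a) * q_num 3)"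
    unfolding M_def u_def by (simp add: unfold_box divide_simps)
  \<comment> \<open>Expanded, the left side is \<open>q ^ (c + 1) (1 - q ^ (a + 1)) (1 - q ^ 3)\<close> over \<open>(1 - q)\<^sup>2\<close>.\<close>
  have 3: "u - q_num (?n + 3) * q_num (Suc c) = qvar ^ Suc c * (q_num (Suc a) * q_num 3)"
    unfolding u_def q_num_def
    by (simp add: divide_simps power_add eval_nat_numeral) (simp add: algebra_simps)
  have "(M - macmahon_box 3 (Suc a) c * macmahon_box 3 (Suc a) (Suc (Suc c))) * u =
      M * (u - q_num (?n + 3) * q_num (Suc c))"
    unfolding left_diff_distrib 1 by (simp add: algebra_simps)
  also have "\<dots> = qvar ^ Suc c * macmahon_box 4 a (Suc c) * macmahon_box 2 (Suc (Suc a)) (Suc c) * u"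
    unfolding 3 using 2 by (simp add: mult_ac)
  finally show ?thesis using u unfolding M_def by simp
qed

theorem theorem6p4:
  fixes k :: nat
  shows "q_log_concave_from k (\<lambda>n. q_baxter n k)"
  unfolding q_log_concave_from_def
proof (intro allI impI)
  fix n i :: nat
  assume n: "k + 1 \<le> n"
  define D where "D = (q_baxter n k)\<^sup>2 - q_baxter (n - 1) k * q_baxter (n + 1) k"
  have D: "to_fract D =
      (q_baxter_fract n k)\<^sup>2 - q_baxter_fract (n - 1) k * q_baxter_fract (n + 1) k"
    using n by (simp add: D_def to_fract_power to_fract_q_baxter)
  have "\<exists>e. nonneg_coeffs (qvar ^ e * to_fract D)"
  proof (cases k)
    case 0
    hence "to_fract D = 0"
      using q_baxter_fract_eq_macmahon_box[of 0] by (simp add: D macmahon_box_def)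
    thus ?thesis by simp
  next
    case (Suc a)
    obtain c where c: "n = k + Suc c"
      using less_imp_Suc_add[of k n] n by auto
    define w where "w = qvar ^ (3 * k * (k - 1) div 2)"
    have "q_baxter_fract n k = w * macmahon_box 3 (Suc a) (Suc c)"
        "q_baxter_fract (n - 1) k = w * macmahon_box 3 (Suc a) c"
        "q_baxter_fract (n + 1) k = w * macmahon_box 3 (Suc a) (Suc (Suc c))"
      using q_baxter_fract_eq_macmahon_box[of k "Suc c"] q_baxter_fract_eq_macmahon_box[of k c]
        q_baxter_fract_eq_macmahon_box[of k "Suc (Suc c)"]
      unfolding w_def by (simp_all add: c Suc)
    hence "to_fract D = w\<^sup>2 * ((macmahon_box 3 (Suc a) (Suc c))\<^sup>2 -
        macmahon_box 3 (Suc a) c * macmahon_box 3 (Suc a) (Suc (Suc c)))"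
      unfolding D by (simp add: power2_eq_square algebra_simps)
    hence eq: "to_fract D = w\<^sup>2 * qvar ^ Suc c *
        (macmahon_box 4 a (Suc c) * macmahon_box 2 (Suc (Suc a)) (Suc c))"
      unfolding macmahon_box_condensation by (simp add: mult_ac)
    obtain e1 where e1: "nonneg_coeffs (qvar ^ e1 * macmahon_box 4 a (Suc c))"
      using nonneg_coeffs_macmahon_box[of 4] by auto
    obtain e2 where e2: "nonneg_coeffs (qvar ^ e2 * macmahon_box 2 (Suc (Suc a)) (Suc c))"
      using nonneg_coeffs_macmahon_box[of 2] by auto
    have "qvar ^ (e1 + e2) * to_fract D = w\<^sup>2 * qvar ^ Suc c *
        ((qvar ^ e1 * macmahon_box 4 a (Suc c)) *
         (qvar ^ e2 * macmahon_box 2 (Suc (Suc a)) (Suc c)))"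
      unfolding eq power_add by (simp only: mult_ac)
    moreover have "nonneg_coeffs (w\<^sup>2 * qvar ^ Suc c)"
      by (simp add: w_def nonneg_coeffs_mult flip: power_mult del: power_Suc)
    ultimately have "nonneg_coeffs (qvar ^ (e1 + e2) * to_fract D)"
      using nonneg_coeffs_mult[OF _ nonneg_coeffs_mult[OF e1 e2]] by simp
    thus ?thesis by blast
  qed
  thus "0 \<le> coeff ((q_baxter n k)\<^sup>2 - q_baxter (n - 1) k * q_baxter (n + 1) k) i"
    unfolding D_def[symmetric] using coeff_nonneg_if_qvar_power_mult by blast
qed

end
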